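(* Suppose that the following assumptions are satisfied: (1) $X$ is a finite dimensional normed space; (2) $A$ is closed; (3) there exists a globally optimal solution of the problem $(\mathcal{P})$; (4) $\Phi$ is lower semicontinuous on the set $A \times \{ 0 \}$; (5) the function $\langle \lambda, \cdot \rangle$ is continuous at the origin for any $\lambda \in \Lambda$; (6) $\sigma$ has a valley at zero; (7) for any $\lambda \in \mathcal{A}_{loc}(\mathcal{P})$ the function $\mathscr{L}(\cdot, \lambda, r)$ is lower semicontinuous on $A$ for any sufficiently large $r \ge 0$ (how large might depend on $\lambda$). Then the set $\mathcal{A}(\mathcal{P})$ consists of all those $\lambda \in \mathcal{A}_{loc}(\mathcal{P})$ for which there exist $r_0 \ge 0$ and $\delta > 0$ such that the set $$\Big\{ x \in A \Bigm| \mathscr{L}(x, \lambda, r_0) < f^*, \: \varphi(x) < \delta \Big\}$$ is bounded or empty, and the function $\mathscr{L}(\cdot, \lambda, r_0)$ is bounded below on $A$.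
   Context: Setting. $X$ is a topological space (here a finite dimensional normed space), $A \subset X$ is a nonempty set, $f \colon X \to \mathbb{R} \cup \{+\infty\}$, and $(\mathcal{P})$ denotes the problem of minimizing $f(x)$ subject to $x \in A$. It is assumed that $\{x \in A \mid f(x) < +\infty\} \ne \emptyset$ and that the optimal value $f^* = \inf_{x \in A} f(x)$ is finite. $P$ is a topological vector space of parameters, $\Lambda$ is a vector space of multipliers, and $\langle \cdot, \cdot \rangle \colon \Lambda \times P \to \mathbb{R}$ is a bilinear coupling function. $\Phi \colon X \times P \to \overline{\mathbb{R}} = \mathbb{R} \cup \{\pm\infty\}$ is a fixed dualizing parameterization function for $f$, i.e. $\Phi(x, 0) = f(x)$ for all $x \in X$. $\sigma \colon P \to [0, +\infty]$ is a fixed augmenting function, i.e. $\sigma(0) = 0$ and $\sigma(p) > 0$ for all $p \in P \setminus \{0\}$. The optimal value function is $v(p) = \inf_{x \in A} \Phi(x, p)$, so $v(0) = f^*$. The augmented Lagrangian is $\mathscr{L}(x, \lambda, r) = \inf_{p \in P} ( \Phi(x, p) - \langle \lambda, p \rangle + r \sigma(p) )$ for $x \in X$, $\lambda \in \Lambda$, $r \ge 0$. The penalty term associated with $\mathscr{L}$ is $\varphi(x) = \inf\{ \sigma(p) \mid p \in P, \: \Phi(x, p) < +\infty \}$ for $x \in X$. A multiplier $\lambda \in \Lambda$ is an augmented Lagrange multiplier of $(\mathcal{P})$ if there exists $r \ge 0$ such that $v(p) \ge v(0) + \langle \lambda, p \rangle - r \sigma(p)$ for all $p \in P$. The set of all augmented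 Lagrange multipliers of $(\mathcal{P})$ is denoted $\mathcal{A}(\mathcal{P})$. Let $x^*$ be a locally optimal solution of $(\mathcal{P})$. A multiplier $\lambda \in \Lambda$ is a (local) augmented Lagrange multiplier at $x^*$ if there exists $r_0 \ge 0$ such that for any $r \ge r_0$ the point $x^*$ is a local minimizer of $\mathscr{L}(\cdot, \lambda, r)$ on $A$, and $\mathscr{L}(x^*, \lambda, r) = f(x^* )$. The set of all such $\lambda$ is denoted $\mathcal{A}(x^* )$. Finally, $\mathcal{A}_{loc}(\mathcal{P}) = \bigcap \mathcal{A}(x^* )$, where the intersection is over all globally optimal solutions $x^*$ of $(\mathcal{P})$. $\sigma$ has a valley at zero if for any neighbourhood $U \subset P$ of zero there exists $\delta > 0$ such that $\sigma(p) \ge \delta$ for all $p \in P \setminus U$. *)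

theory Defs
  imports "HOL-Analysis.Analysis"
begin

text \<open>Real topological vector spaces; no separation axiom is imposed.\<close>

class real_topological_vector_space = real_vector + topological_ab_group_add +
  assumes tendsto_scaleR_Pair:
    "LIM x (nhds c \<times>\<^sub>F nhds a). fst x *\<^sub>R snd x :> nhds (c *\<^sub>R a)"

instance real_normed_vector \<subseteq> real_topological_vector_space
proof
  fix c :: real and a :: 'a
  show "LIM x (nhds c \<times>\<^sub>F nhds a). fst x *\<^sub>R snd x :> nhds (c *\<^sub>R a)"
    by (intro tendsto_scaleR filterlim_fst filterlim_snd)
qed

text \<open>Lower semicontinuity of \<open>g\<close> at every point of \<open>S\<close>, as a function on the whole
  space: neighbourhoods are not relativized to \<open>S\<close>.\<close>

definition lsc_on :: "'a::topological_space set \<Rightarrow> ('a \<Rightarrow> ereal) \<Rightarrow> bool" where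
  "lsc_on S g \<longleftrightarrow> (\<forall>x\<in>S. \<forall>c < g x. \<forall>\<^sub>F y in nhds x. c < g y)"

definition local_minimizer_on :: "'a::topological_space set \<Rightarrow> ('a \<Rightarrow> ereal) \<Rightarrow> 'a \<Rightarrow> bool" where
  "local_minimizer_on A g x \<longleftrightarrow> x \<in> A \<and> (\<forall>\<^sub>F y in nhds x. y \<in> A \<longrightarrow> g x \<le> g y)"

definition globally_optimal :: "'a set \<Rightarrow> ('a \<Rightarrow> ereal) \<Rightarrow> 'a \<Rightarrow> bool" where
  "globally_optimal A f x \<longleftrightarrow> x \<in> A \<and> (\<forall>y\<in>A. f x \<le> f y)"

definition opt_value :: "'a set \<Rightarrow> ('a \<Rightarrow> ereal) \<Rightarrow> ereal" where
  "opt_value A f = (INF x\<in>A. f x)"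

definition dualizing_parameterization :: "('x \<Rightarrow> ereal) \<Rightarrow> ('x \<Rightarrow> 'p::zero \<Rightarrow> ereal) \<Rightarrow> bool" where
  "dualizing_parameterization f \<Phi> \<longleftrightarrow> (\<forall>x. \<Phi> x 0 = f x)"

definition augmenting_function :: "('p::zero \<Rightarrow> ereal) \<Rightarrow> bool" where
  "augmenting_function \<sigma> \<longleftrightarrow> \<sigma> 0 = 0 \<and> (\<forall>p. p \<noteq> 0 \<longrightarrow> 0 < \<sigma> p)"

definition valley_at_zero :: "('p::{topological_space, zero} \<Rightarrow> ereal) \<Rightarrow> bool" where
  "valley_at_zero \<sigma> \<longleftrightarrow>
     (\<forall>U. (\<forall>\<^sub>F p in nhds 0. p \<in> U) \<longrightarrow> (\<exists>\<delta>::real. 0 < \<delta> \<and> (\<forall>p. p \<notin> U \<longrightarrow> ereal \<delta> \<le> \<sigma> p)))"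

definition value_function :: "'x set \<Rightarrow> ('x \<Rightarrow> 'p \<Rightarrow> ereal) \<Rightarrow> 'p \<Rightarrow> ereal" where
  "value_function A \<Phi> p = (INF x\<in>A. \<Phi> x p)"

text \<open>Arithmetic on \<^typ>\<open>ereal\<close> fixes the conventions \<open>\<infinity> + (-\<infinity>) = (-\<infinity>) + \<infinity> = \<infinity>\<close>
  (the usual one for infima in the augmented Lagrangian) and \<open>0 * \<infinity> = 0\<close>.\<close>

definition aug_Lagrangian ::
  "('x \<Rightarrow> 'p \<Rightarrow> ereal) \<Rightarrow> ('l \<Rightarrow> 'p \<Rightarrow> real) \<Rightarrow> ('p \<Rightarrow> ereal) \<Rightarrow> 'x \<Rightarrow> 'l \<Rightarrow> real \<Rightarrow> ereal" where
  "aug_Lagrangian \<Phi> B \<sigma> x \<mu> r = (INF p. \<Phi> x p - ereal (B \<mu> p) + ereal r * \<sigma> p)"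

definition penalty_term :: "('x \<Rightarrow> 'p \<Rightarrow> ereal) \<Rightarrow> ('p \<Rightarrow> ereal) \<Rightarrow> 'x \<Rightarrow> ereal" where
  "penalty_term \<Phi> \<sigma> x = Inf {\<sigma> p | p. \<Phi> x p < \<infinity>}"

definition aug_multipliers ::
  "'x set \<Rightarrow> ('x \<Rightarrow> 'p::zero \<Rightarrow> ereal) \<Rightarrow> ('l \<Rightarrow> 'p \<Rightarrow> real) \<Rightarrow> ('p \<Rightarrow> ereal) \<Rightarrow> 'l set" where
  "aug_multipliers A \<Phi> B \<sigma> =
     {\<mu>. \<exists>r\<ge>0. \<forall>p. value_function A \<Phi> p
                     \<ge> value_function A \<Phi> 0 + ereal (B \<mu> p) - ereal r * \<sigma> p}"

definition aug_multipliers_at ::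
  "'x::topological_space set \<Rightarrow> ('x \<Rightarrow> ereal) \<Rightarrow> ('x \<Rightarrow> 'p \<Rightarrow> ereal) \<Rightarrow> ('l \<Rightarrow> 'p \<Rightarrow> real)
     \<Rightarrow> ('p \<Rightarrow> ereal) \<Rightarrow> 'x \<Rightarrow> 'l set" where
  "aug_multipliers_at A f \<Phi> B \<sigma> x =
     {\<mu>. \<exists>r\<^sub>0\<ge>0. \<forall>r\<ge>r\<^sub>0. local_minimizer_on A (\<lambda>y. aug_Lagrangian \<Phi> B \<sigma> y \<mu> r) x
                          \<and> aug_Lagrangian \<Phi> B \<sigma> x \<mu> r = f x}"

definition aug_multipliers_loc ::
  "'x::topological_space set \<Rightarrow> ('x \<Rightarrow> ereal) \<Rightarrow> ('x \<Rightarrow> 'p \<Rightarrow> ereal) \<Rightarrow> ('l \<Rightarrow> 'p \<Rightarrow> real)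
     \<Rightarrow> ('p \<Rightarrow> ereal) \<Rightarrow> 'l set" where
  "aug_multipliers_loc A f \<Phi> B \<sigma> =
     (\<Inter>x\<in>{x. globally_optimal A f x}. aug_multipliers_at A f \<Phi> B \<sigma> x)"

end

theory Submission
  imports Defs
begin

text \<open>If no penalty parameter works, there are points \<open>x\<^sub>n \<in> A\<close> and perturbations \<open>p\<^sub>n\<close> at which the
  penalized objective with parameter \<open>r\<^sub>n \<rightarrow> \<infinity>\<close> lies below the optimal value. The lower bound for
  \<open>r\<^sub>0\<close> forces \<open>\<sigma> p\<^sub>n \<rightarrow> 0\<close>, so \<open>p\<^sub>n \<rightarrow> 0\<close> by the valley condition, and \<open>\<phi> x\<^sub>n \<rightarrow> 0\<close>, so the \<open>x\<^sub>n\<close>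
  stay in the bounded set and cluster at some \<open>x \<in> A\<close>. Lower semicontinuity of \<open>\<Phi>\<close> makes \<open>x\<close>
  globally optimal, and the local multiplier property at \<open>x\<close> contradicts the choice of \<open>x\<^sub>n\<close>.\<close>

section \<open>Subsequences in finite dimensional normed spaces\<close>

text \<open>Induction on the spanning set: for \<open>b\<close> outside \<open>span S\<close>, the
  coefficient of \<open>b\<close> in a vector is at most its norm divided by the distance from
  \<open>b\<close> to \<open>span S\<close>. Coefficients and remainders in \<open>span S\<close>
  are then both bounded, and two successive extractions give a limit.\<close>

lemma bounded_span_convergent_subsequence:
  fixes S :: "'a::real_normed_vector set"
  assumes "finite S" "bounded (range X)" "range X \<subseteq> span S"
  shows "\<exists>l\<in>span S. \<exists>r. strict_mono (r :: nat \<Rightarrow> nat) \<and> (X \<circ> r) \<longlonglongrightarrow> l"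
  using assms
proof (induction S arbitrary: X rule: finite_induct)
  case empty
  then have "X = (\<lambda>_. 0)" by auto
  then have "(X \<circ> id) \<longlonglongrightarrow> 0" by (simp add: o_def)
  then show ?case using strict_mono_id by auto
next
  case (insert b S)
  show ?case
  proof (cases "b \<in> span S")
    case True
    then show ?thesis using insert by (simp add: span_redundant)
  next
    case False
    \<comment> \<open>The induction hypothesis, applied to a convergent sequence, places its limit
      in \<open>span S\<close>. Closedness is what makes the distance from \<open>b\<close>
      positive.\<close>
    have "closed (span S)"
      unfolding closed_sequential_limits
    proof (intro allI impI, elim conjE)
      fix Y l assume Y: "\<forall>n. Y n \<in> span S" "Y \<longlonglongrightarrow> l"
      then obtain l' r where l': "l' \<in> span S" "strict_mono r" "(Y \<circ> r) \<longlonglongrightarrow> l'"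
        using insert.IH[of Y] convergent_imp_bounded by blast
      then have "l' = l" using Y(2) LIMSEQ_subseq_LIMSEQ LIMSEQ_unique by blast
      then show "l \<in> span S" using l' by simp
    qed
    then have d: "infdist b (span S) > 0" (is "?d > 0")
      using False span_zero by (intro infdist_pos_not_in_closed) auto
    have "\<forall>n. \<exists>k. X n - k *\<^sub>R b \<in> span S"
      using insert.prems(2) by (auto simp: span_breakdown_eq[symmetric])
    then obtain t where t: "\<And>n. X n - t n *\<^sub>R b \<in> span S" by metis
    obtain M where M: "\<And>n. norm (X n) \<le> M"
      using insert.prems(1) by (auto simp: bounded_iff)
    have "norm (t n) \<le> M / ?d" for n
    proof (cases "t n = 0")
      case True
      have "0 \<le> M" using M[of n] norm_ge_zero order_trans by blast
      then show ?thesis using True d by simp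
    next
      case False
      \<comment> \<open>A multiple of the remainder, hence a point of \<open>span S\<close>, at
        distance exactly \<open>norm (X n) / \<bar>t n\<bar>\<close> from \<open>b\<close>.\<close>
      let ?y = "b - (1 / t n) *\<^sub>R X n"
      have "?y = (- 1 / t n) *\<^sub>R (X n - t n *\<^sub>R b)"
        using False by (simp add: algebra_simps)
      then have "?y \<in> span S" using t[of n] span_scale by metis
      then have "?d \<le> dist b ?y" by (rule infdist_le)
      also have "\<dots> = norm (X n) / \<bar>t n\<bar>" by (simp add: dist_norm)
      finally have "?d * \<bar>t n\<bar> \<le> norm (X n)" using False by (simp add: field_simps)
      then show ?thesis using M[of n] d by (simp add: field_simps)
    qed
    then have bt: "bounded (range t)" by (auto simp: bounded_iff)
    then obtain s r1 where r1: "strict_mono (r1 :: nat \<Rightarrow> nat)" "(t \<circ> r1) \<longlonglongrightarrow> s"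
      using bounded_imp_convergent_subsequence by blast
    let ?Y = "\<lambda>n. X (r1 n) - t (r1 n) *\<^sub>R b"
    have "bounded (range ?Y)"
    proof -
      obtain K where K: "\<And>n. \<bar>t n\<bar> \<le> K" using bt by (auto simp: bounded_iff)
      have "norm (?Y n) \<le> M + K * norm b" for n
        using norm_triangle_ineq4[of "X (r1 n)" "t (r1 n) *\<^sub>R b"] M[of "r1 n"]
          mult_right_mono[OF K[of "r1 n"], of "norm b"] by simp
      then show ?thesis by (auto simp: bounded_iff)
    qed
    moreover have "range ?Y \<subseteq> span S" using t by auto
    ultimately obtain l r2 where r2: "l \<in> span S" "strict_mono r2" "(?Y \<circ> r2) \<longlonglongrightarrow> l"
      using insert.IH[of ?Y] by blast
    have "(\<lambda>n. (?Y \<circ> r2) n + ((t \<circ> r1) \<circ> r2) n *\<^sub>R b) \<longlonglongrightarrow> l + s *\<^sub>R b"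
      using r2 LIMSEQ_subseq_LIMSEQ[OF r1(2) r2(2)] by (intro tendsto_intros)
    then have "(X \<circ> (r1 \<circ> r2)) \<longlonglongrightarrow> l + s *\<^sub>R b" by (simp add: o_def)
    moreover have "l + s *\<^sub>R b \<in> span (insert b S)"
      using r2(1) by (auto simp: span_breakdown_eq intro!: exI[of _ s])
    ultimately show ?thesis using strict_mono_o[OF r1(1) r2(2)] by blast
  qed
qed

lemma finite_dimensional_convergent_subsequence:
  fixes X :: "nat \<Rightarrow> 'a::real_normed_vector"
  assumes "finite_dimensional_vector_space ((*\<^sub>R) :: real \<Rightarrow> 'a \<Rightarrow> 'a) E"
    and "bounded (range X)"
  obtains l r where "strict_mono (r :: nat \<Rightarrow> nat)" "(X \<circ> r) \<longlonglongrightarrow> l"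
proof -
  interpret finite_dimensional_vector_space "(*\<^sub>R) :: real \<Rightarrow> 'a \<Rightarrow> 'a" E by fact
  have "Real_Vector_Spaces.span E = UNIV"
    using span_Basis by (simp add: span_raw_def)
  then show ?thesis
    using bounded_span_convergent_subsequence[OF finite_Basis assms(2)] that by auto
qed

section \<open>Elementary properties of the augmented Lagrangian\<close>

lemma augmenting_function_nonneg: "augmenting_function \<sigma> \<Longrightarrow> 0 \<le> \<sigma> p"
  by (cases "p = 0") (auto simp: augmenting_function_def less_imp_le)

lemma aug_Lagrangian_mono:
  assumes "augmenting_function \<sigma>" "r \<le> r'"
  shows "aug_Lagrangian \<Phi> B \<sigma> x \<mu> r \<le> aug_Lagrangian \<Phi> B \<sigma> x \<mu> r'"
  unfolding aug_Lagrangian_def using assms augmenting_function_nonneg[OF assms(1)]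
  by (intro INF_mono') (auto intro!: add_left_mono ereal_mult_right_mono)

text \<open>The perturbation 0 competes in the infimum, and there both coupling and penalty
  vanish.\<close>

lemma aug_Lagrangian_le_objective:
  assumes "dualizing_parameterization f \<Phi>" "augmenting_function \<sigma>" "B \<mu> 0 = 0"
  shows "aug_Lagrangian \<Phi> B \<sigma> x \<mu> r \<le> f x"
  unfolding aug_Lagrangian_def using assms
  by (intro INF_lower2[of 0])
    (auto simp: dualizing_parameterization_def augmenting_function_def zero_ereal_def[symmetric])

text \<open>Both sides unfold to one inequality for all \<open>x\<close> in \<open>A\<close> and all
  \<open>p\<close>, solved for \<open>\<Phi> x p\<close> on the right. If \<open>\<sigma> p\<close>
  is infinite and \<open>r\<close> positive, it holds trivially in both forms, even for
  \<open>\<Phi> x p\<close> equal to minus infinity; if \<open>r\<close> is 0, the penalty is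
  0.\<close>

lemma aug_Lagrangian_ge_iff:
  assumes "augmenting_function \<sigma>" "0 \<le> r"
  shows "(\<forall>x\<in>A. ereal m \<le> aug_Lagrangian \<Phi> B \<sigma> x \<mu> r) \<longleftrightarrow>
    (\<forall>p. ereal m + ereal (B \<mu> p) - ereal r * \<sigma> p \<le> value_function A \<Phi> p)"
proof -
  have "ereal m \<le> \<Phi> x p - ereal (B \<mu> p) + ereal r * \<sigma> p \<longleftrightarrow>
      ereal m + ereal (B \<mu> p) - ereal r * \<sigma> p \<le> \<Phi> x p" for x p
    using augmenting_function_nonneg[OF assms(1), of p] assms(2)
    by (cases "\<sigma> p"; cases "\<Phi> x p"; cases "r = 0") auto
  then show ?thesis
    unfolding aug_Lagrangian_def value_function_def le_INF_iff by blast
qed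

section \<open>Control of the perturbations\<close>

lemma valley_at_zero_tendsto:
  assumes "valley_at_zero \<sigma>" "\<And>\<epsilon>::real. 0 < \<epsilon> \<Longrightarrow> \<forall>\<^sub>F n in F. \<sigma> (p n) < ereal \<epsilon>"
  shows "(p \<longlongrightarrow> 0) F"
proof (rule topological_tendstoI)
  fix U :: "'a set" assume "open U" "0 \<in> U"
  then have "\<forall>\<^sub>F q in nhds 0. q \<in> U" by (rule eventually_nhds_in_open)
  then obtain \<delta> :: real where "0 < \<delta>" "\<And>q. q \<notin> U \<Longrightarrow> ereal \<delta> \<le> \<sigma> q"
    using assms(1) unfolding valley_at_zero_def by blast
  then show "\<forall>\<^sub>F n in F. p n \<in> U"
    using assms(2)[of \<delta>] by (auto elim!: eventually_mono simp: not_le[symmetric])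
qed

text \<open>The penalized values at \<open>p\<close> for the parameters \<open>r\<close> and
  \<open>r\<^sub>0\<close> differ by \<open>(r - r\<^sub>0) * \<sigma> p\<close>; one is below
  \<open>m\<close>, the other at least \<open>c\<close>. Dropping the nonnegative penalty gives the
  last bound.\<close>

lemma augmenting_le_of_Lagrangian_bounds:
  assumes "augmenting_function \<sigma>" "0 \<le> r\<^sub>0" "r\<^sub>0 < r"
    and "ereal c \<le> aug_Lagrangian \<Phi> B \<sigma> x \<mu> r\<^sub>0"
    and "\<Phi> x p - ereal (B \<mu> p) + ereal r * \<sigma> p < ereal m"
  shows "\<Phi> x p < \<infinity>" "\<sigma> p \<le> ereal ((m - c) / (r - r\<^sub>0))" "\<Phi> x p < ereal (m + B \<mu> p)"
proof -
  have 1: "ereal c \<le> \<Phi> x p - ereal (B \<mu> p) + ereal r\<^sub>0 * \<sigma> p"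
    using assms(4) unfolding aug_Lagrangian_def le_INF_iff by blast
  have s: "0 \<le> \<sigma> p" by (rule augmenting_function_nonneg) fact
  \<comment> \<open>As \<open>r\<close> is positive, an infinite penalty would make the penalized
    value infinite, not below \<open>m\<close>.\<close>
  have s': "\<sigma> p \<noteq> \<infinity>" using assms by auto
  then obtain s where s_eq: "\<sigma> p = ereal s" "0 \<le> s" using s by (cases "\<sigma> p") auto
  obtain y where y: "\<Phi> x p = ereal y"
    using 1 assms(5) s_eq by (cases "\<Phi> x p") auto
  have 2: "c \<le> y - B \<mu> p + r\<^sub>0 * s" "y - B \<mu> p + r * s < m"
    using 1 assms(5) s_eq y by auto
  then have "s * (r - r\<^sub>0) \<le> m - c" by (simp add: algebra_simps)
  then show "\<sigma> p \<le> ereal ((m - c) / (r - r\<^sub>0))"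
    using s_eq assms(3) by (simp add: pos_le_divide_eq)
  show "\<Phi> x p < \<infinity>" using y by simp
  have "0 \<le> r * s" using s_eq assms by simp
  then show "\<Phi> x p < ereal (m + B \<mu> p)" using 2 y by simp
qed

section \<open>From local multipliers to a global lower bound\<close>

lemma exists_aug_Lagrangian_ge:
  fixes A :: "'x::real_normed_vector set"
    and \<Phi> :: "'x \<Rightarrow> 'p::real_topological_vector_space \<Rightarrow> ereal"
  assumes fin: "finite_dimensional_vector_space ((*\<^sub>R) :: real \<Rightarrow> 'x \<Rightarrow> 'x) E"
    and A: "closed A"
    and dual: "dualizing_parameterization f \<Phi>"
    and aug: "augmenting_function \<sigma>"
    and lsc: "lsc_on (A \<times> {0}) (\<lambda>(x, p). \<Phi> x p)"
    and B0: "B \<mu> 0 = 0"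
    and cont: "(B \<mu> \<longlongrightarrow> B \<mu> 0) (nhds 0)"
    and valley: "valley_at_zero \<sigma>"
    and opt: "opt_value A f = ereal m"
    and loc: "\<mu> \<in> aug_multipliers_loc A f \<Phi> B \<sigma>"
    and r0: "0 \<le> r\<^sub>0"
    and \<delta>: "0 < \<delta>"
    and bdd: "bounded {x \<in> A. aug_Lagrangian \<Phi> B \<sigma> x \<mu> r\<^sub>0 < ereal m
                \<and> penalty_term \<Phi> \<sigma> x < ereal \<delta>}"
    and below: "\<And>x. x \<in> A \<Longrightarrow> ereal c \<le> aug_Lagrangian \<Phi> B \<sigma> x \<mu> r\<^sub>0"
  shows "\<exists>r\<ge>0. \<forall>x\<in>A. ereal m \<le> aug_Lagrangian \<Phi> B \<sigma> x \<mu> r"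
proof (rule ccontr)
  \<comment> \<open>The successor keeps \<open>r n\<close> strictly above \<open>r\<^sub>0\<close>
    also for \<open>n = 0\<close>, so the bound on \<open>\<sigma> (p n)\<close> has denominator
    \<open>n + 1\<close>.\<close>
  define r where "r n = r\<^sub>0 + real (Suc n)" for n
  assume "\<not> ?thesis"
  moreover have "0 \<le> r n" for n using r0 by (simp add: r_def)
  ultimately have "\<forall>n. \<exists>x\<in>A. aug_Lagrangian \<Phi> B \<sigma> x \<mu> (r n) < ereal m"
    by (meson not_le)
  then obtain x where x: "\<And>n. x n \<in> A" "\<And>n. aug_Lagrangian \<Phi> B \<sigma> (x n) \<mu> (r n) < ereal m"
    by metis
  have "\<forall>n. \<exists>p. \<Phi> (x n) p - ereal (B \<mu> p) + ereal (r n) * \<sigma> p < ereal m"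
    using x(2) unfolding aug_Lagrangian_def INF_less_iff by blast
  then obtain p where
    p: "\<And>n. \<Phi> (x n) (p n) - ereal (B \<mu> (p n)) + ereal (r n) * \<sigma> (p n) < ereal m"
    by metis
  have r_gt: "r\<^sub>0 < r n" for n by (simp add: r_def)
  note bounds = augmenting_le_of_Lagrangian_bounds[OF aug r0 r_gt below[OF x(1)] p]
  have small: "\<forall>\<^sub>F n in sequentially. \<sigma> (p n) < ereal \<epsilon>" if "0 < \<epsilon>" for \<epsilon> :: real
  proof -
    have "(\<lambda>n. (m - c) / real (Suc n)) \<longlonglongrightarrow> 0"
      by (rule lim_const_over_n[THEN LIMSEQ_Suc])
    then have "\<forall>\<^sub>F n in sequentially. (m - c) / real (Suc n) < \<epsilon>"
      using that by (rule order_tendstoD)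
    then show ?thesis
    proof eventually_elim
      case (elim n)
      then show ?case
        using bounds(2)[of n] by (auto simp: r_def intro: le_less_trans)
    qed
  qed
  have p0: "p \<longlonglongrightarrow> 0" by (rule valley_at_zero_tendsto[OF valley small])
  \<comment> \<open>Only the tail from \<open>N\<close> on is known to have penalty term below
    \<delta>; hence the shift in the sequence from which a subsequence is drawn.\<close>
  obtain N where N: "\<And>n. n \<ge> N \<Longrightarrow> \<sigma> (p n) < ereal \<delta>"
    using small[OF \<delta>] unfolding eventually_sequentially by blast
  have "range (\<lambda>n. x (n + N)) \<subseteq> {x \<in> A. aug_Lagrangian \<Phi> B \<sigma> x \<mu> r\<^sub>0 < ereal m
                \<and> penalty_term \<Phi> \<sigma> x < ereal \<delta>}"
  proof clarify
    fix n
    have "penalty_term \<Phi> \<sigma> (x (n + N)) \<le> \<sigma> (p (n + N))"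
      unfolding penalty_term_def using bounds(1) by (intro Inf_lower) blast
    moreover have "aug_Lagrangian \<Phi> B \<sigma> (x (n + N)) \<mu> r\<^sub>0 < ereal m"
      using aug_Lagrangian_mono[OF aug less_imp_le[OF r_gt]] x(2) by (rule le_less_trans)
    ultimately show "x (n + N) \<in> A \<and> aug_Lagrangian \<Phi> B \<sigma> (x (n + N)) \<mu> r\<^sub>0 < ereal m
                \<and> penalty_term \<Phi> \<sigma> (x (n + N)) < ereal \<delta>"
      using N[of "n + N"] x(1) by (auto intro: le_less_trans)
  qed
  then have "bounded (range (\<lambda>n. x (n + N)))" using bdd bounded_subset by blast
  then obtain l k where k: "strict_mono (k :: nat \<Rightarrow> nat)" "((\<lambda>n. x (n + N)) \<circ> k) \<longlonglongrightarrow> l"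
    by (rule finite_dimensional_convergent_subsequence[OF fin])
  define j where "j n = k n + N" for n
  have j: "strict_mono j" using k(1) by (simp add: j_def strict_mono_def)
  have xj: "(\<lambda>n. x (j n)) \<longlonglongrightarrow> l" using k(2) by (simp add: j_def o_def)
  have pj: "(\<lambda>n. p (j n)) \<longlonglongrightarrow> 0" using LIMSEQ_subseq_LIMSEQ[OF p0 j] by (simp add: o_def)
  have l: "l \<in> A" using closed_sequentially[OF A _ xj] x(1) by blast
  have "(\<lambda>n. B \<mu> (p (j n))) \<longlonglongrightarrow> 0"
    using filterlim_compose[OF cont pj] B0 by simp
  then have lim: "(\<lambda>n. ereal (m + B \<mu> (p (j n)))) \<longlonglongrightarrow> ereal m"
    by (auto intro!: tendsto_eq_intros)
  \<comment> \<open>Otherwise some \<open>a\<close> lies strictly between \<open>m\<close> and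
    \<open>f l\<close>. Lower semicontinuity at \<open>(l, 0)\<close> keeps \<Phi> above
    \<open>a\<close> along the subsequence, while the upper bounds
    \<open>m + B \<mu> (p (j n))\<close> tend to \<open>m\<close>.\<close>
  have "f l \<le> ereal m"
  proof (rule ccontr)
    assume "\<not> ?thesis"
    then obtain a where a: "ereal m < a" "a < f l" using dense by (auto simp: not_le)
    have "\<forall>\<^sub>F z in nhds (l, 0). a < (case z of (x, p) \<Rightarrow> \<Phi> x p)"
      using lsc l a(2) dual unfolding lsc_on_def dualizing_parameterization_def by auto
    with tendsto_Pair[OF xj pj] have "\<forall>\<^sub>F n in sequentially. a < \<Phi> (x (j n)) (p (j n))"
      unfolding filterlim_iff by fastforce
    moreover have "\<forall>\<^sub>F n in sequentially. ereal (m + B \<mu> (p (j n))) < a"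
      using order_tendstoD(2)[OF lim a(1)] .
    ultimately have "\<forall>\<^sub>F n in sequentially. False"
    proof eventually_elim
      case (elim n)
      then show ?case using bounds(3)[of "j n"] by (meson less_asym less_trans)
    qed
    then show False by simp
  qed
  then have gopt: "globally_optimal A f l"
    using l opt unfolding globally_optimal_def opt_value_def
    by (metis INF_lower order_trans)
  then have fl: "f l = ereal m"
    using opt l \<open>f l \<le> ereal m\<close> unfolding opt_value_def by (metis INF_lower antisym)
  \<comment> \<open>A single parameter suffices: the neighbourhood of \<open>l\<close> may depend on
    \<open>r'\<close>, and monotonicity in the parameter carries the lower bound \<open>m\<close>
    over to \<open>r (j n)\<close> once that exceeds \<open>r'\<close>.\<close>
  obtain r' where r': "local_minimizer_on A (\<lambda>y. aug_Lagrangian \<Phi> B \<sigma> y \<mu> r') l"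
    "aug_Lagrangian \<Phi> B \<sigma> l \<mu> r' = f l"
    using loc gopt unfolding aug_multipliers_loc_def aug_multipliers_at_def by blast
  have "\<forall>\<^sub>F n in sequentially. ereal m \<le> aug_Lagrangian \<Phi> B \<sigma> (x (j n)) \<mu> r'"
    using r' fl x(1) filterlim_iff[THEN iffD1, OF xj]
    unfolding local_minimizer_on_def by fastforce
  moreover have "\<forall>\<^sub>F n in sequentially. r' \<le> r (j n)"
  proof -
    obtain K :: nat where K: "r' \<le> real K" using real_arch_simple by blast
    have "r' \<le> r (j n)" if "n \<ge> K" for n
      using K that r0 seq_suble[OF j, of n] by (simp add: r_def)
    then show ?thesis unfolding eventually_sequentially by blast
  qed
  ultimately have "\<forall>\<^sub>F n in sequentially. False"
  proof eventually_elim
    case (elim n)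
    then show ?case
      using aug_Lagrangian_mono[OF aug elim(2), of \<Phi> B "x (j n)" \<mu>] x(2)[of "j n"] by auto
  qed
  then show False by simp
qed

section \<open>Characterization of the augmented Lagrange multipliers\<close>

theorem theorem3:
  fixes A :: "'x::real_normed_vector set"
    and f :: "'x \<Rightarrow> ereal"
    and \<Phi> :: "'x \<Rightarrow> 'p::real_topological_vector_space \<Rightarrow> ereal"
    and B :: "'l::real_vector \<Rightarrow> 'p \<Rightarrow> real"
    and \<sigma> :: "'p \<Rightarrow> ereal"
  assumes "A \<noteq> {}"
    and "\<forall>x. f x \<noteq> -\<infinity>"
    and "{x \<in> A. f x < \<infinity>} \<noteq> {}"
    and "\<bar>opt_value A f\<bar> \<noteq> \<infinity>"
    and "bilinear B"
    and "dualizing_parameterization f \<Phi>"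
    and "augmenting_function \<sigma>"
    and "\<exists>Basis. finite_dimensional_vector_space ((*\<^sub>R) :: real \<Rightarrow> 'x \<Rightarrow> 'x) Basis"
    and "closed A"
    and "\<exists>x. globally_optimal A f x"
    and "lsc_on (A \<times> {0}) (\<lambda>(x, p). \<Phi> x p)"
    and "\<forall>\<mu>. (B \<mu> \<longlongrightarrow> B \<mu> 0) (nhds 0)"
    and "valley_at_zero \<sigma>"
    and "\<forall>\<mu>\<in>aug_multipliers_loc A f \<Phi> B \<sigma>.
           \<exists>r\<^sub>1\<ge>0. \<forall>r\<ge>r\<^sub>1. lsc_on A (\<lambda>x. aug_Lagrangian \<Phi> B \<sigma> x \<mu> r)"
  shows "aug_multipliers A \<Phi> B \<sigma> =
    {\<mu> \<in> aug_multipliers_loc A f \<Phi> B \<sigma>.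
      \<exists>r\<^sub>0\<ge>0. \<exists>\<delta>>0.
        (let S = {x \<in> A. aug_Lagrangian \<Phi> B \<sigma> x \<mu> r\<^sub>0 < opt_value A f
                          \<and> penalty_term \<Phi> \<sigma> x < ereal \<delta>}
         in bounded S \<or> S = {})
        \<and> (\<exists>c::real. \<forall>x\<in>A. ereal c \<le> aug_Lagrangian \<Phi> B \<sigma> x \<mu> r\<^sub>0)}"
proof -
  obtain m where m: "opt_value A f = ereal m"
    using assms(4) by (cases "opt_value A f") auto
  have v0: "value_function A \<Phi> 0 = ereal m"
    using m assms(6)
    by (simp add: value_function_def opt_value_def dualizing_parameterization_def)
  have B0: "B \<mu> 0 = 0" for \<mu> using assms(5) by (rule bilinear_rzero)
  \<comment> \<open>Being a multiplier thus means that the optimal value bounds the Lagrangian from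
    below on \<open>A\<close> for some parameter; both inclusions use this form.\<close>
  have mult_iff: "\<mu> \<in> aug_multipliers A \<Phi> B \<sigma> \<longleftrightarrow>
      (\<exists>r\<ge>0. \<forall>x\<in>A. ereal m \<le> aug_Lagrangian \<Phi> B \<sigma> x \<mu> r)" for \<mu>
    using aug_Lagrangian_ge_iff[OF assms(7), of _ A m \<Phi> B \<mu>]
    unfolding aug_multipliers_def v0 by auto
  show ?thesis
  proof (intro set_eqI iffI)
    fix \<mu> assume "\<mu> \<in> aug_multipliers A \<Phi> B \<sigma>"
    then obtain r where r: "0 \<le> r" "\<And>x. x \<in> A \<Longrightarrow> ereal m \<le> aug_Lagrangian \<Phi> B \<sigma> x \<mu> r"
      unfolding mult_iff by blast
    \<comment> \<open>The threshold is \<open>r\<close> itself: for every larger parameter the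
      Lagrangian is at least \<open>f x\<close> on all of \<open>A\<close> and at most
      \<open>f x\<close> at \<open>x\<close>, so \<open>x\<close> is even a global minimizer on
      \<open>A\<close>.\<close>
    have "\<mu> \<in> aug_multipliers_at A f \<Phi> B \<sigma> x" if "globally_optimal A f x" for x
    proof -
      have x: "x \<in> A" "f x \<le> ereal m"
        using that unfolding globally_optimal_def m[symmetric] opt_value_def
        by (auto intro: INF_greatest)
      have upper: "aug_Lagrangian \<Phi> B \<sigma> x \<mu> s \<le> f x" for s
        using assms(6,7) B0 by (rule aug_Lagrangian_le_objective)
      have "local_minimizer_on A (\<lambda>y. aug_Lagrangian \<Phi> B \<sigma> y \<mu> s) x"
        "aug_Lagrangian \<Phi> B \<sigma> x \<mu> s = f x" if "r \<le> s" for s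
      proof -
        have lower: "f x \<le> aug_Lagrangian \<Phi> B \<sigma> y \<mu> s" if "y \<in> A" for y
          using order_trans[OF x(2) r(2)[OF that]] aug_Lagrangian_mono[OF assms(7) \<open>r \<le> s\<close>]
          by (rule order_trans)
        then show eq: "aug_Lagrangian \<Phi> B \<sigma> x \<mu> s = f x"
          using x(1) upper by (intro antisym)
        show "local_minimizer_on A (\<lambda>y. aug_Lagrangian \<Phi> B \<sigma> y \<mu> s) x"
          unfolding local_minimizer_on_def eq using x(1) lower by (simp add: always_eventually)
      qed
      then show ?thesis using r(1) unfolding aug_multipliers_at_def by blast
    qed
    then have loc: "\<mu> \<in> aug_multipliers_loc A f \<Phi> B \<sigma>" unfolding aug_multipliers_loc_def by blast
    \<comment> \<open>With \<open>r\<^sub>0 = r\<close> no point of \<open>A\<close> has Lagrangian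
      below the optimal value, so the choice of 1 for \<delta> is arbitrary; \<open>m\<close> serves
      as lower bound.\<close>
    have empty: "{x \<in> A. aug_Lagrangian \<Phi> B \<sigma> x \<mu> r < opt_value A f
        \<and> penalty_term \<Phi> \<sigma> x < ereal 1} = {}"
      using r(2) m by (auto simp: not_less[symmetric])
    show "\<mu> \<in> {\<mu> \<in> aug_multipliers_loc A f \<Phi> B \<sigma>.
      \<exists>r\<^sub>0\<ge>0. \<exists>\<delta>>0.
        (let S = {x \<in> A. aug_Lagrangian \<Phi> B \<sigma> x \<mu> r\<^sub>0 < opt_value A f
                          \<and> penalty_term \<Phi> \<sigma> x < ereal \<delta>}
         in bounded S \<or> S = {})
        \<and> (\<exists>c::real. \<forall>x\<in>A. ereal c \<le> aug_Lagrangian \<Phi> B \<sigma> x \<mu> r\<^sub>0)}"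
      unfolding mem_Collect_eq Let_def
    proof (rule conjI[OF loc], rule exI[of _ r], rule conjI[OF r(1)], rule exI[of _ 1],
        intro conjI)
      show "\<exists>c::real. \<forall>x\<in>A. ereal c \<le> aug_Lagrangian \<Phi> B \<sigma> x \<mu> r" using r(2) by blast
    qed (use empty in \<open>simp_all only: simp_thms zero_less_one\<close>)
  next
    fix \<mu> assume "\<mu> \<in> {\<mu> \<in> aug_multipliers_loc A f \<Phi> B \<sigma>.
      \<exists>r\<^sub>0\<ge>0. \<exists>\<delta>>0.
        (let S = {x \<in> A. aug_Lagrangian \<Phi> B \<sigma> x \<mu> r\<^sub>0 < opt_value A f
                          \<and> penalty_term \<Phi> \<sigma> x < ereal \<delta>}
         in bounded S \<or> S = {})
        \<and> (\<exists>c::real. \<forall>x\<in>A. ereal c \<le> aug_Lagrangian \<Phi> B \<sigma> x \<mu> r\<^sub>0)}"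
    then obtain r\<^sub>0 \<delta> c where loc: "\<mu> \<in> aug_multipliers_loc A f \<Phi> B \<sigma>"
      and r0: "0 \<le> r\<^sub>0" and \<delta>: "0 < \<delta>"
      and S: "bounded {x \<in> A. aug_Lagrangian \<Phi> B \<sigma> x \<mu> r\<^sub>0 < ereal m
                \<and> penalty_term \<Phi> \<sigma> x < ereal \<delta>}
        \<or> {x \<in> A. aug_Lagrangian \<Phi> B \<sigma> x \<mu> r\<^sub>0 < ereal m
                \<and> penalty_term \<Phi> \<sigma> x < ereal \<delta>} = {}"
      and below: "\<forall>x\<in>A. ereal c \<le> aug_Lagrangian \<Phi> B \<sigma> x \<mu> r\<^sub>0"
      unfolding mem_Collect_eq Let_def m by (elim conjE exE)
    from S have bdd: "bounded {x \<in> A. aug_Lagrangian \<Phi> B \<sigma> x \<mu> r\<^sub>0 < ereal m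
                \<and> penalty_term \<Phi> \<sigma> x < ereal \<delta>}"
      by (rule disjE) (simp_all only: bounded_empty)
    obtain E where E: "finite_dimensional_vector_space ((*\<^sub>R) :: real \<Rightarrow> 'x \<Rightarrow> 'x) E"
      using assms(8) by blast
    show "\<mu> \<in> aug_multipliers A \<Phi> B \<sigma>"
      unfolding mult_iff
      by (rule exists_aug_Lagrangian_ge[OF E assms(9,6,7,11) B0 assms(12)[rule_format] assms(13) m
            loc r0 \<delta> bdd below[rule_format]])
  qed
qed

end
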